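(* Let $v_A>0$ and $v_D>0$ be the maximum speeds of an attacker $A$ and a single defender $D$, with speed ratio $\nu = v_D/v_A > 1$. Consider the perfect-information, point-capture, zero-sum Phase II pursuit game (defined in the context) starting at time $t_s$ from a configuration $\mathbf{x}(t_s) = [\mathbf{x}_D^\top(t_s), \mathbf{x}_A^\top(t_s)]^\top$ with $\mathbf{x}_D(t_s), \mathbf{x}_A(t_s)\in \Omega=[0,1]\times[0,1]$ and $\|\mathbf{x}_A(t_s)-\mathbf{x}_D(t_s)\|=\rho_s$, where $\rho_s\ge 0$ is the defender's sensing radius. Let $$\mathbf{c} = (c_x,c_y)^\top= \frac{\nu^2 \mathbf{x}_A(t_s) - \mathbf{x}_D(t_s)}{\nu^2 - 1}, \qquad r = \frac{\nu \|\mathbf{x}_A(t_s) - \mathbf{x}_D(t_s)\|}{|\nu^2 - 1|}$$ be the center and radius of the Apollonius circle of $(\mathbf{x}_A(t_s),\mathbf{x}_D(t_s),\nu)$. Then the Nash equilibrium (saddle-point) payoff of this game is $$J^*(\mathbf{x}(t_s)) = \max\{0,\, c_y - r\}.$$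
   Context: **Dynamics.** Positions are $\mathbf{x}_k(t)=[x_k(t),y_k(t)]^\top\in\mathbb{R}^2$ for $k\in\{D,A\}$, evolving by single-integrator dynamics $\dot{\mathbf{x}}_k = v_k\mathbf{u}_k$, with controls $\mathbf{u}_k\in\mathcal{U}=\{\mathbf{u}\in\mathbb{R}^2 : \|\mathbf{u}\|\le 1\}$. No other constraint is imposed on the motion. **Target.** The target line is the bottom edge $y=0$ of the environment $\Omega=[0,1]\times[0,1]$. **Information and policies.** In Phase II ($t\ge t_s$) both players know the full state $\mathbf{x}(t)=[\mathbf{x}_D^\top(t),\mathbf{x}_A^\top(t)]^\top\in\mathbb{R}^4$ and use state-feedback policies $\gamma_D,\gamma_A:\mathbb{R}^4\to\mathcal{U}$, i.e. $\mathbf{u}_k(t)=\gamma_k(\mathbf{x}(t))$. **Termination.** The game ends at $t_f=\inf\{t\ge t_s : \mathbf{x}(t)\in\mathcal{S}_A\cup\mathcal{S}_D\}$, where $\mathcal{S}_A=\{\mathbf{x}: y_A=0\}$ (the attacker reaches the target line) and $\mathcal{S}_D=\{\mathbf{x}:\|\mathbf{x}_A-\mathbf{x}_D\|\le\rho_c\}$ (capture), with capture radius $\rho_c=0$ (point capture, $\mathbf{x}_A=\mathbf{x}_D$). **Payoff.** $J=\max\{0,y_A(t_f)\}$. The defender maximizes $J$ and the attacker minimizes $J$. **Nash equilibrium payoff.** The value $J^*=J(\gamma_D^*,\gamma_A^* )$ at a saddle-point pair of policies, meaning $J(\gamma_D,\gamma_A^* )\le J(\gamma_D^*,\gamma_A^*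 )\le J(\gamma_D^*,\gamma_A)$ for all admissible policies $\gamma_D,\gamma_A$. **Apollonius circle.** $\mathcal{A}(\mathbf{x}_A,\mathbf{x}_D,\nu)$ is the locus of points $\mathbf{p}\in\mathbb{R}^2$ with $\|\mathbf{p}-\mathbf{x}_A\|/\|\mathbf{p}-\mathbf{x}_D\|=1/\nu$; for $\nu>1$ it is the circle with the center $\mathbf{c}$ and radius $r$ given in the claim. *)

theory Defs
  imports "HOL-Analysis.Analysis"
begin

(* A state is the pair (x_D, x_A) of the positions of the defender and the attacker. *)

type_synonym state = "(real^2) \<times> (real^2)"
type_synonym policy = "state \<Rightarrow> real^2"

definition environment :: "(real^2) set" where
  "environment = {p. 0 \<le> p$1 \<and> p$1 \<le> 1 \<and> 0 \<le> p$2 \<and> p$2 \<le> 1}"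

definition controls :: "(real^2) set" where
  "controls = {u. norm u \<le> 1}"

definition target_set :: "state set" where
  "target_set = {s. snd s $ 2 = 0}"

definition capture_set :: "real \<Rightarrow> state set" where
  "capture_set \<rho> = {s. norm (snd s - fst s) \<le> \<rho>}"

definition terminal_set :: "state set" where
  "terminal_set = target_set \<union> capture_set 0"

(* The times up to and including the first entry into the terminal set. *)

definition running_times :: "real \<Rightarrow> (real \<Rightarrow> state) \<Rightarrow> real set" where
  "running_times t\<^sub>s x = {t. t\<^sub>s \<le> t \<and> (\<forall>s. t\<^sub>s \<le> s \<and> s < t \<longrightarrow> x s \<notin> terminal_set)}"

(* A play is a Caratheodory solution of the closed-loop system
     x_D' = v_D g_D(x),  x_A' = v_A g_A(x),  x(t_s) = x0,
   written as an integral equation.  It is a solution up to the end of the game, or for all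
   times if the game does not end; after the end of the game the motion is irrelevant and only
   continuity is asked for, which makes the infimum in the definition of t_f attained. *)

definition play ::
  "real \<Rightarrow> real \<Rightarrow> real \<Rightarrow> state \<Rightarrow> policy \<Rightarrow> policy \<Rightarrow> (real \<Rightarrow> state) \<Rightarrow> bool" where
  "play v\<^sub>D v\<^sub>A t\<^sub>s x0 \<gamma>\<^sub>D \<gamma>\<^sub>A x \<longleftrightarrow>
     x t\<^sub>s = x0 \<and> continuous_on {t\<^sub>s..} x \<and>
     (\<forall>t \<in> running_times t\<^sub>s x.
        ((\<lambda>s. v\<^sub>D *\<^sub>R \<gamma>\<^sub>D (x s)) has_integral (fst (x t) - fst x0)) {t\<^sub>s..t} \<and>
        ((\<lambda>s. v\<^sub>A *\<^sub>R \<gamma>\<^sub>A (x s)) has_integral (snd (x t) - snd x0)) {t\<^sub>s..t})"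

definition terminates :: "real \<Rightarrow> (real \<Rightarrow> state) \<Rightarrow> bool" where
  "terminates t\<^sub>s x \<longleftrightarrow> (\<exists>t\<ge>t\<^sub>s. x t \<in> terminal_set)"

definition final_time :: "real \<Rightarrow> (real \<Rightarrow> state) \<Rightarrow> real" where
  "final_time t\<^sub>s x = Inf {t. t\<^sub>s \<le> t \<and> x t \<in> terminal_set}"

definition payoff :: "real \<Rightarrow> (real \<Rightarrow> state) \<Rightarrow> real" where
  "payoff t\<^sub>s x = max 0 (snd (x (final_time t\<^sub>s x)) $ 2)"

(* Some well-posedness must be asked of state-feedback policies, since the closed-loop system
   of two arbitrary maps into the control set need not have any solution.  Locally Lipschitz
   policies always yield plays, but the class of admissible policies is not restricted to
   them: a policy, possibly discontinuous, is admissible if it has a play against each locally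
   Lipschitz policy of the opponent. *)

definition lipschitz_policy :: "policy \<Rightarrow> bool" where
  "lipschitz_policy \<gamma> \<longleftrightarrow>
     range \<gamma> \<subseteq> controls \<and> local_lipschitz (UNIV :: real set) (- terminal_set) (\<lambda>_. \<gamma>)"

definition admissible_D :: "real \<Rightarrow> real \<Rightarrow> real \<Rightarrow> state \<Rightarrow> policy \<Rightarrow> bool" where
  "admissible_D v\<^sub>D v\<^sub>A t\<^sub>s x0 \<gamma>\<^sub>D \<longleftrightarrow>
     range \<gamma>\<^sub>D \<subseteq> controls \<and>
     (\<forall>\<gamma>\<^sub>A. lipschitz_policy \<gamma>\<^sub>A \<longrightarrow> (\<exists>x. play v\<^sub>D v\<^sub>A t\<^sub>s x0 \<gamma>\<^sub>D \<gamma>\<^sub>A x))"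

definition admissible_A :: "real \<Rightarrow> real \<Rightarrow> real \<Rightarrow> state \<Rightarrow> policy \<Rightarrow> bool" where
  "admissible_A v\<^sub>D v\<^sub>A t\<^sub>s x0 \<gamma>\<^sub>A \<longleftrightarrow>
     range \<gamma>\<^sub>A \<subseteq> controls \<and>
     (\<forall>\<gamma>\<^sub>D. lipschitz_policy \<gamma>\<^sub>D \<longrightarrow> (\<exists>x. play v\<^sub>D v\<^sub>A t\<^sub>s x0 \<gamma>\<^sub>D \<gamma>\<^sub>A x))"

(* The saddle-point inequalities with value j.  A pair of admissible policies may have several
   plays, so each inequality is required of every play; and since J is undefined on a play that
   does not end, every play compared has to end. *)

definition saddle_point ::
  "real \<Rightarrow> real \<Rightarrow> real \<Rightarrow> state \<Rightarrow> policy \<Rightarrow> policy \<Rightarrow> real \<Rightarrow> bool" where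
  "saddle_point v\<^sub>D v\<^sub>A t\<^sub>s x0 \<gamma>\<^sub>D \<gamma>\<^sub>A j \<longleftrightarrow>
     admissible_D v\<^sub>D v\<^sub>A t\<^sub>s x0 \<gamma>\<^sub>D \<and> admissible_A v\<^sub>D v\<^sub>A t\<^sub>s x0 \<gamma>\<^sub>A \<and>
     (\<exists>x. play v\<^sub>D v\<^sub>A t\<^sub>s x0 \<gamma>\<^sub>D \<gamma>\<^sub>A x) \<and>
     (\<forall>x. play v\<^sub>D v\<^sub>A t\<^sub>s x0 \<gamma>\<^sub>D \<gamma>\<^sub>A x \<longrightarrow> terminates t\<^sub>s x \<and> payoff t\<^sub>s x = j) \<and>
     (\<forall>\<gamma>. admissible_D v\<^sub>D v\<^sub>A t\<^sub>s x0 \<gamma> \<longrightarrow>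
        (\<forall>x. play v\<^sub>D v\<^sub>A t\<^sub>s x0 \<gamma> \<gamma>\<^sub>A x \<longrightarrow> terminates t\<^sub>s x \<and> payoff t\<^sub>s x \<le> j)) \<and>
     (\<forall>\<gamma>. admissible_A v\<^sub>D v\<^sub>A t\<^sub>s x0 \<gamma> \<longrightarrow>
        (\<forall>x. play v\<^sub>D v\<^sub>A t\<^sub>s x0 \<gamma>\<^sub>D \<gamma> x \<longrightarrow> terminates t\<^sub>s x \<and> j \<le> payoff t\<^sub>s x))"

definition nash_payoff :: "real \<Rightarrow> real \<Rightarrow> real \<Rightarrow> state \<Rightarrow> real \<Rightarrow> bool" where
  "nash_payoff v\<^sub>D v\<^sub>A t\<^sub>s x0 j \<longleftrightarrow> (\<exists>\<gamma>\<^sub>D \<gamma>\<^sub>A. saddle_point v\<^sub>D v\<^sub>A t\<^sub>s x0 \<gamma>\<^sub>D \<gamma>\<^sub>A j)"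

definition apollonius_circle :: "real^2 \<Rightarrow> real^2 \<Rightarrow> real \<Rightarrow> (real^2) set" where
  "apollonius_circle x\<^sub>A x\<^sub>D \<nu> = {p. norm (p - x\<^sub>A) / norm (p - x\<^sub>D) = 1 / \<nu>}"

definition apollonius_center :: "real^2 \<Rightarrow> real^2 \<Rightarrow> real \<Rightarrow> real^2" where
  "apollonius_center x\<^sub>A x\<^sub>D \<nu> = (1 / (\<nu>\<^sup>2 - 1)) *\<^sub>R (\<nu>\<^sup>2 *\<^sub>R x\<^sub>A - x\<^sub>D)"

definition apollonius_radius :: "real^2 \<Rightarrow> real^2 \<Rightarrow> real \<Rightarrow> real" where
  "apollonius_radius x\<^sub>A x\<^sub>D \<nu> = \<nu> * norm (x\<^sub>A - x\<^sub>D) / \<bar>\<nu>\<^sup>2 - 1\<bar>"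

lemma apollonius_circle_eq_sphere:
  assumes "\<nu> > 1" "x\<^sub>A \<noteq> x\<^sub>D"
  shows "apollonius_circle x\<^sub>A x\<^sub>D \<nu> =
    sphere (apollonius_center x\<^sub>A x\<^sub>D \<nu>) (apollonius_radius x\<^sub>A x\<^sub>D \<nu>)"
proof -
  have pos: "\<nu>\<^sup>2 - 1 > 0"
    using assms(1) by (simp add: one_less_power)
  have "p \<in> apollonius_circle x\<^sub>A x\<^sub>D \<nu> \<longleftrightarrow>
      p \<in> sphere (apollonius_center x\<^sub>A x\<^sub>D \<nu>) (apollonius_radius x\<^sub>A x\<^sub>D \<nu>)" for p
  proof -
    define P where "P = p - x\<^sub>A"
    define Q where "Q = p - x\<^sub>D"
    have "p - apollonius_center x\<^sub>A x\<^sub>D \<nu> = (1 / (\<nu>\<^sup>2 - 1)) *\<^sub>R (\<nu>\<^sup>2 *\<^sub>R P - Q)"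
    proof -
      have "(1 / (\<nu>\<^sup>2 - 1)) *\<^sub>R (\<nu>\<^sup>2 *\<^sub>R P - Q)
          = (1 / (\<nu>\<^sup>2 - 1)) *\<^sub>R ((\<nu>\<^sup>2 - 1) *\<^sub>R p) - apollonius_center x\<^sub>A x\<^sub>D \<nu>"
        unfolding apollonius_center_def P_def Q_def scaleR_diff_right[symmetric]
        by (simp add: algebra_simps)
      then show ?thesis
        using pos by simp
    qed
    then have d: "dist (apollonius_center x\<^sub>A x\<^sub>D \<nu>) p = norm (\<nu>\<^sup>2 *\<^sub>R P - Q) / (\<nu>\<^sup>2 - 1)"
      using pos by (simp add: dist_norm norm_minus_commute)
    have r: "apollonius_radius x\<^sub>A x\<^sub>D \<nu> = norm (\<nu> *\<^sub>R (P - Q)) / (\<nu>\<^sup>2 - 1)"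
      using pos assms(1)
      by (simp add: apollonius_radius_def P_def Q_def norm_minus_commute)
    have eq: "(norm (\<nu>\<^sup>2 *\<^sub>R P - Q))\<^sup>2 - (norm (\<nu> *\<^sub>R (P - Q)))\<^sup>2
        = (\<nu>\<^sup>2 - 1) * ((\<nu> * norm P)\<^sup>2 - (norm Q)\<^sup>2)"
      unfolding power_mult_distrib power2_norm_eq_inner
      by (simp add: inner_diff_left inner_diff_right inner_commute[of Q P]
          algebra_simps power2_eq_square)
    have "p \<in> sphere (apollonius_center x\<^sub>A x\<^sub>D \<nu>) (apollonius_radius x\<^sub>A x\<^sub>D \<nu>)
        \<longleftrightarrow> norm (\<nu>\<^sup>2 *\<^sub>R P - Q) = norm (\<nu> *\<^sub>R (P - Q))"
      using pos by (simp add: d r)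
    also have "\<dots> \<longleftrightarrow> (norm (\<nu>\<^sup>2 *\<^sub>R P - Q))\<^sup>2 = (norm (\<nu> *\<^sub>R (P - Q)))\<^sup>2"
      by (simp add: power2_eq_iff_nonneg)
    also have "\<dots> \<longleftrightarrow> (\<nu> * norm P)\<^sup>2 = (norm Q)\<^sup>2"
      using eq pos by (metis right_minus_eq mult_eq_0_iff less_irrefl)
    also have "\<dots> \<longleftrightarrow> \<nu> * norm P = norm Q"
      using assms(1) by (simp add: power2_eq_iff_nonneg)
    also have "\<dots> \<longleftrightarrow> norm P / norm Q = 1 / \<nu>"
    proof (cases "Q = 0")
      case True
      then have "P \<noteq> 0"
        using assms(2) by (auto simp: P_def Q_def)
      then show ?thesis
        using True assms(1) by simp
    next
      case False
      then show ?thesis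
        using assms(1) by (auto simp: field_simps)
    qed
    finally show ?thesis
      by (simp add: apollonius_circle_def P_def Q_def)
  qed
  then show ?thesis
    by blast
qed

end

theory Submission
  imports Defs "HOL-Complex_Analysis.Great_Picard"
begin

text \<open>
  Write \<open>e\<close> for the unit vector from the defender to the attacker and \<open>y\<close> for the upward unit
  vector. The height \<open>V\<close> of the lowest point of the current Apollonius circle satisfies
  \<open>V' = v\<^sub>D / (\<nu>\<^sup>2 - 1) * (u\<^sub>A \<bullet> (\<nu> y - e) + u\<^sub>D \<bullet> (\<nu> e - y))\<close>. The two vectors multiplying the
  controls have equal norm, so the controls aligned with \<open>\<nu> e - y\<close> and \<open>e - \<nu> y\<close> make \<open>V\<close>
  nondecreasing against every attacker and nonincreasing against every defender. At capture \<open>V\<close> is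
  the height of the attacker, and on the target line it is at most \<open>0\<close>. The first control ends the
  game because it makes the nonnegative quantity \<open>\<nu> \<bar>x\<^sub>A - x\<^sub>D\<bar> + y\<^sub>D - y\<^sub>A\<close> decrease at a fixed
  rate, the second because the attacker descends at a fixed rate. Since controls are only
  integrable in time, these rates are integrated by a one-sided difference quotient argument.
  Both policies are Lipschitz off the terminal set, so Peano's theorem provides their plays.
\<close>

section \<open>Growth along integral curves\<close>

text \<open>Continuous induction. For a slope \<open>c + e\<close> the times at which the bound
  holds form a compact set containing \<open>a\<close>; its maximum is \<open>b\<close>, since from
  an earlier maximum the one-sided estimate would carry the bound further to the right. The slack
  \<open>e\<close> then tends to zero.\<close>

lemma right_slope_le_imp_le:
  fixes \<phi> :: "real \<Rightarrow> real"
  assumes ab: "a \<le> b" and cont: "continuous_on {a..b} \<phi>"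
    and slope: "\<And>t e. \<lbrakk>a \<le> t; t < b; 0 < e\<rbrakk> \<Longrightarrow>
      \<forall>\<^sub>F s in at_right t. \<phi> s \<le> \<phi> t + (c + e) * (s - t)"
  shows "\<phi> b \<le> \<phi> a + c * (b - a)"
proof -
  have le: "\<phi> b \<le> \<phi> a + (c + e) * (b - a)" if e: "0 < e" for e
  proof -
    define S where "S = {t \<in> {a..b}. \<phi> t \<le> \<phi> a + (c + e) * (t - a)}"
    have "closed S"
      unfolding S_def
      by (intro continuous_on_closed_Collect_le continuous_intros cont)
    moreover have "bounded S"
      by (rule bounded_subset[of "{a..b}"]) (auto simp: S_def)
    moreover have "a \<in> S"
      using ab by (simp add: S_def)
    ultimately obtain m where m: "m \<in> S" and max: "\<And>t. t \<in> S \<Longrightarrow> t \<le> m"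
      using compact_attains_sup[of S] by (auto simp: compact_eq_bounded_closed)
    have "m = b"
    proof (rule ccontr)
      assume "m \<noteq> b"
      with m have mb: "a \<le> m" "m < b"
        by (auto simp: S_def)
      have "\<forall>\<^sub>F s in at_right m. \<phi> s \<le> \<phi> m + (c + e) * (s - m) \<and> m < s \<and> s < b"
        using slope[OF mb e] eventually_at_right_less[of m] eventually_at_right_real[OF mb(2)]
        by eventually_elim auto
      then obtain s where s: "\<phi> s \<le> \<phi> m + (c + e) * (s - m)" "m < s" "s < b"
        by (metis (mono_tags, lifting) eventually_happens' trivial_limit_at_right_real)
      then have "\<phi> s \<le> \<phi> a + (c + e) * (s - a)"
        using m by (simp add: S_def algebra_simps)
      then show False
        using max[of s] s mb by (auto simp: S_def)
    qed
    then show ?thesis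
      using m by (simp add: S_def)
  qed
  show ?thesis
  proof (rule field_le_epsilon)
    fix e :: real assume e: "0 < e"
    \<comment> \<open>Adding \<open>1\<close> keeps the denominator positive when
      \<open>a = b\<close>.\<close>
    have "e / (b - a + 1) * (b - a) \<le> e"
      using ab e by (simp add: field_simps)
    moreover have "\<phi> b \<le> \<phi> a + (c + e / (b - a + 1)) * (b - a)"
      using ab e by (intro le) simp
    ultimately show "\<phi> b \<le> \<phi> a + c * (b - a) + e"
      by (simp add: distrib_right)
  qed
qed

text \<open>The curve only solves an integral equation, so the chain rule may fail at a given time.
  Instead \<open>F\<close> is linearised at \<open>x t\<close>, and the linear map
  \<open>F' t\<close> passes under the integral over \<open>{t..s}\<close>. The rate is bounded on a
  neighbourhood of \<open>x t\<close> and not just at that point, because \<open>f\<close> may jump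
  there.\<close>

lemma integral_curve_upper_bound:
  fixes x :: "real \<Rightarrow> 'a::euclidean_space" and F :: "'a \<Rightarrow> real"
  assumes ab: "a \<le> b" and contx: "continuous_on {a..b} x"
    and int: "\<And>t. t \<in> {a..b} \<Longrightarrow> ((\<lambda>s. f (x s)) has_integral x t - x a) {a..t}"
    and bound: "\<And>z. norm (f z) \<le> M"
    and contF: "continuous_on UNIV F"
    and deriv: "\<And>t. \<lbrakk>a \<le> t; t < b\<rbrakk> \<Longrightarrow> (F has_derivative F' t) (at (x t))"
    and rate: "\<And>t e. \<lbrakk>a \<le> t; t < b; 0 < e\<rbrakk> \<Longrightarrow> \<forall>\<^sub>F z in nhds (x t). F' t (f z) \<le> c + e"
  shows "F (x b) \<le> F (x a) + c * (b - a)"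
proof (rule right_slope_le_imp_le[OF ab, of "\<lambda>t. F (x t)"])
  show "continuous_on {a..b} (\<lambda>t. F (x t))"
    using continuous_on_compose2[OF contF contx] by simp
next
  fix t e :: real assume t: "a \<le> t" "t < b" and e: "0 < e"
  have M: "0 \<le> M"
    using bound norm_ge_zero order_trans by blast
  have lin: "bounded_linear (F' t)"
    using deriv[OF t] by (rule has_derivative_bounded_linear)
  have int': "((\<lambda>s. f (x s)) has_integral x s - x t) {t..s}" if "t \<le> s" "s \<le> b" for s
  proof -
    have "(\<lambda>s. f (x s)) integrable_on {a..s}"
      using int[of s] t that by auto
    moreover from this have "(\<lambda>s. f (x s)) integrable_on {t..s}"
      by (rule integrable_subinterval_real) (use t in auto)
    moreover have "integral {a..t} (\<lambda>s. f (x s)) = x t - x a"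
        "integral {a..s} (\<lambda>s. f (x s)) = x s - x a"
      using int[of t] int[of s] t that by (auto intro!: integral_unique)
    moreover from this have "integral {t..s} (\<lambda>s. f (x s)) = x s - x t"
      using Henstock_Kurzweil_Integration.integral_combine[of a t s "\<lambda>s. f (x s)"] t that
      by (metis add_diff_cancel_left' calculation(1) diff_diff_eq2 diff_add_cancel)
    ultimately show ?thesis
      by (simp add: has_integral_iff)
  qed
  have step: "norm (x s - x t) \<le> M * (s - t)" if "t \<le> s" "s \<le> b" for s
    using has_integral_bound_real[OF M finite.emptyI int'[OF that]] bound that by simp
  \<comment> \<open>The slack \<open>e\<close> is halved: one half pays for the linearisation error,
    which \<open>e' * M \<le> e / 2\<close> ensures, the other for the rate. The \<open>1\<close>
    added to \<open>M\<close> covers the case \<open>M = 0\<close>.\<close>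
  define e' where "e' = e / (2 * (M + 1))"
  have e': "0 < e'" "e' * M \<le> e / 2"
    using e M by (auto simp: e'_def field_simps)
  obtain d where d: "0 < d"
    "\<And>y. norm (y - x t) < d \<Longrightarrow> norm (F y - F (x t) - F' t (y - x t)) \<le> e' * norm (y - x t)"
    using deriv[OF t] e'(1) unfolding has_derivative_at_alt by metis
  obtain d2 where d2: "0 < d2" "\<And>z. dist z (x t) < d2 \<Longrightarrow> F' t (f z) \<le> c + e / 2"
    using rate[OF t, of "e / 2"] e by (auto simp: eventually_nhds_metric)
  \<comment> \<open>For a time shorter than \<open>h\<close> a curve of speed at most
    \<open>M\<close> stays within both radii \<open>d\<close> and \<open>d2\<close> of
    \<open>x t\<close>.\<close>
  define h where "h = min d d2 / (M + 1)"
  have h: "0 < h" "h * M < d" "h * M < d2"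
  proof -
    show "0 < h" using d d2 M by (simp add: h_def)
    have "h * M < h * (M + 1)" using \<open>0 < h\<close> by simp
    also have "h * (M + 1) = min d d2" using M by (simp add: h_def)
    finally show "h * M < d" "h * M < d2" by auto
  qed
  have small: "norm (x s - x t) < d \<and> norm (x s - x t) < d2" if "t \<le> s" "s \<le> b" "s < t + h" for s
  proof -
    have "norm (x s - x t) \<le> h * M"
      using step[OF that(1,2)] mult_right_mono[of "s - t" h M] M that
      by (simp add: mult.commute)
    then show ?thesis using h by simp
  qed
  have "\<forall>\<^sub>F s in at_right t. t < s \<and> s < b \<and> s < t + h"
    using eventually_at_right_less[of t] eventually_at_right_real[OF t(2)]
      eventually_at_right_real[of t "t + h"] h(1)
    by (auto elim: eventually_elim2)
  then show "\<forall>\<^sub>F s in at_right t. F (x s) \<le> F (x t) + (c + e) * (s - t)"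
  proof eventually_elim
    case (elim s)
    have "((\<lambda>s. F' t (f (x s))) has_integral F' t (x s - x t)) {t..s}"
      using has_integral_linear[OF int' lin] elim by (simp add: o_def)
    moreover have "((\<lambda>_. c + e / 2) has_integral (c + e / 2) * (s - t)) {t..s}"
      using has_integral_const_real[of "c + e / 2" t s] elim by (simp add: mult.commute)
    ultimately have "F' t (x s - x t) \<le> (c + e / 2) * (s - t)"
      by (rule has_integral_le) (use elim small d2 in \<open>auto simp: dist_norm\<close>)
    moreover have "norm (F (x s) - F (x t) - F' t (x s - x t)) \<le> e' * norm (x s - x t)"
      using small[of s] elim by (intro d) auto
    moreover have "e' * norm (x s - x t) \<le> e / 2 * (s - t)"
    proof -
      have "e' * norm (x s - x t) \<le> e' * (M * (s - t))"
        using step[of s] elim e' by (intro mult_left_mono) auto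
      also have "\<dots> = e' * M * (s - t)"
        by simp
      also have "\<dots> \<le> e / 2 * (s - t)"
        using e' elim by (intro mult_right_mono) auto
      finally show ?thesis .
    qed
    moreover have "(c + e) * (s - t) = (c + e / 2) * (s - t) + e / 2 * (s - t)"
      by (simp add: algebra_simps)
    ultimately show ?case
      by (auto simp: abs_le_iff)
  qed
qed

section \<open>Peano existence\<close>

text \<open>The argument of \<open>X\<close> in the integrand is the last grid point up to
  \<open>s\<close>. The node values \<open>y\<close> are computed first by recursion,
  \<open>X\<close> is the integral of the resulting step function, and induction on the nodes shows
  that \<open>X\<close> passes through them.\<close>

lemma euler_polygon_exists:
  fixes f :: "'a::euclidean_space \<Rightarrow> 'a" and a h :: real
  assumes h: "0 < h" and bound: "\<And>z. norm (f z) \<le> M"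
  obtains X where "X a = x0"
    "\<And>t. a \<le> t \<Longrightarrow>
      ((\<lambda>s. f (X (a + h * of_int \<lfloor>(s - a) / h\<rfloor>))) has_integral X t - x0) {a..t}"
proof -
  define y where "y = rec_nat x0 (\<lambda>_ z. z + h *\<^sub>R f z)"
  have y: "y 0 = x0" "\<And>j. y (Suc j) = y j + h *\<^sub>R f (y j)"
    by (simp_all add: y_def)
  define k where "k s = nat \<lfloor>(s - a) / h\<rfloor>" for s
  define X where "X t = x0 + integral {a..t} (\<lambda>s. f (y (k s)))" for t
  \<comment> \<open>Factoring through the discrete space of cell indices gives measurability for an
    arbitrary \<open>f\<close>.\<close>
  have "k \<in> borel \<rightarrow>\<^sub>M count_space UNIV"
    unfolding k_def by measurable
  then have "(\<lambda>s. f (y (k s))) \<in> borel_measurable borel"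
    by (rule measurable_compose) simp
  then have meas: "(\<lambda>s. f (y (k s))) \<in> borel_measurable (lebesgue_on S)" for S
    by (intro measurable_restrict_space1 measurable_completion) simp
  have integrable: "(\<lambda>s. f (y (k s))) integrable_on {t..s}" for t s
    by (rule measurable_bounded_by_integrable_imp_integrable[OF meas, where g = "\<lambda>_. M"])
      (auto simp: bound)
  have node: "X (a + h * real j) = y j" for j
  proof (induction j)
    case 0
    show ?case by (simp add: X_def y)
  next
    case (Suc j)
    let ?l = "a + h * real j" and ?u = "a + h * real (Suc j)"
    have "((\<lambda>s. f (y (k s))) has_integral h *\<^sub>R f (y j)) {?l..?u}"
    \<comment> \<open>At the right end point the cell index has already jumped to
      \<open>Suc j\<close>, so this single point is discarded.\<close>
    proof (rule has_integral_spike_finite[of "{?u}"])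
      show "((\<lambda>_. f (y j)) has_integral h *\<^sub>R f (y j)) {?l..?u}"
        using has_integral_const_real[of "f (y j)" ?l ?u] h by (simp add: algebra_simps)
      show "f (y (k s)) = f (y j)" if "s \<in> {?l..?u} - {?u}" for s
      proof -
        have "real j \<le> (s - a) / h" "(s - a) / h < real j + 1"
          using that h by (auto simp: field_simps)
        then have "\<lfloor>(s - a) / h\<rfloor> = int j"
          by (simp add: floor_eq_iff)
        then show ?thesis by (simp add: k_def)
      qed
    qed auto
    then have "integral {?l..?u} (\<lambda>s. f (y (k s))) = h *\<^sub>R f (y j)"
      by (rule integral_unique)
    moreover have "integral {a..?l} (\<lambda>s. f (y (k s))) + integral {?l..?u} (\<lambda>s. f (y (k s)))
        = integral {a..?u} (\<lambda>s. f (y (k s)))"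
      by (rule Henstock_Kurzweil_Integration.integral_combine) (use h integrable in auto)
    ultimately have "X ?u = X ?l + h *\<^sub>R f (y j)"
      by (metis X_def add.assoc)
    then show ?case
      by (simp only: Suc y)
  qed
  have grid: "f (X (a + h * of_int \<lfloor>(s - a) / h\<rfloor>)) = f (y (k s))" if "a \<le> s" for s
  proof -
    have "0 \<le> (s - a) / h" using that h by simp
    then have "of_int \<lfloor>(s - a) / h\<rfloor> = real (k s)" by (simp add: k_def)
    then show ?thesis using node by simp
  qed
  show thesis
  proof (rule that)
    show "X a = x0" by (simp add: X_def)
    show "((\<lambda>s. f (X (a + h * of_int \<lfloor>(s - a) / h\<rfloor>))) has_integral X t - x0) {a..t}"
      if "a \<le> t" for t
    proof (rule has_integral_eq)
      show "((\<lambda>s. f (y (k s))) has_integral X t - x0) {a..t}"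
        using integrable by (simp add: X_def has_integral_integral)
    qed (simp add: grid)
  qed
qed

text \<open>An Arzela-Ascoli argument on a half-line: a diagonal subsequence converges at all
  rational times after \<open>a\<close>, and the common Lipschitz constant carries the Cauchy
  property over to every time.\<close>

lemma lipschitz_sequence_convergent_subseq:
  fixes X :: "nat \<Rightarrow> real \<Rightarrow> 'a::euclidean_space"
  assumes init: "\<And>n. X n a = x0"
    and lip: "\<And>n. M-lipschitz_on {a..} (X n)"
  obtains k x where "strict_mono k" "\<And>t. a \<le> t \<Longrightarrow> (\<lambda>n. X (k n) t) \<longlonglongrightarrow> x t"
    "M-lipschitz_on {a..} x"
proof -
  have M: "0 \<le> M"
    using lip lipschitz_on_nonneg by blast
  define S where "S = \<rat> \<inter> {a<..}"
  have dense: "\<exists>q\<in>S. \<bar>t - q\<bar> < e" if t: "a \<le> t" "0 < e" for t e :: real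
  proof -
    obtain q where "q \<in> \<rat>" "t < q" "q < t + e"
      using Rats_dense_in_real[of t "t + e"] t by auto
    then show ?thesis
      using t by (intro bexI[of _ q]) (auto simp: S_def)
  qed
  have lipD: "norm (X n t - X n s) \<le> M * \<bar>t - s\<bar>" if "a \<le> s" "a \<le> t" for n s t
    using lipschitz_onD[OF lip, of t s n] that by (simp add: dist_norm)
  \<comment> \<open>The diagonal argument asks for one bound at all times, but
    \<open>X n t - x0\<close> may grow linearly in \<open>t\<close>; the factor scales it down to
    norm at most \<open>M\<close>.\<close>
  define Z where "Z n t = (1 / (1 + \<bar>t - a\<bar>)) *\<^sub>R (X n t - x0)" for n t
  have "countable S"
    by (simp add: S_def countable_rat)
  moreover have "norm (Z n t) \<le> M" if "t \<in> S" for n t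
  proof -
    have "norm (X n t - x0) \<le> M * \<bar>t - a\<bar>"
      using lipD[of a t n] that by (simp add: init S_def)
    also have "\<dots> \<le> M * (1 + \<bar>t - a\<bar>)"
      using M by (intro mult_left_mono) auto
    finally show ?thesis
      by (simp add: Z_def divide_simps)
  qed
  ultimately obtain k where k: "strict_mono k"
    "\<And>t. t \<in> S \<Longrightarrow> \<exists>l. (\<lambda>n. Z (k n) t) \<longlonglongrightarrow> l"
    using function_convergent_subsequence[of S Z M] by blast
  have conv_S: "Cauchy (\<lambda>n. X (k n) q)" if "q \<in> S" for q
  proof -
    obtain l where "(\<lambda>n. Z (k n) q) \<longlonglongrightarrow> l"
      using k(2) \<open>q \<in> S\<close> by blast
    then have "(\<lambda>n. x0 + (1 + \<bar>q - a\<bar>) *\<^sub>R Z (k n) q) \<longlonglongrightarrow> x0 + (1 + \<bar>q - a\<bar>) *\<^sub>R l"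
      by (intro tendsto_intros)
    moreover have "x0 + (1 + \<bar>q - a\<bar>) *\<^sub>R Z (k n) q = X (k n) q" for n
    proof -
      have "1 + \<bar>q - a\<bar> \<noteq> 0" by linarith
      then show ?thesis by (simp add: Z_def)
    qed
    ultimately show ?thesis
      by (auto intro: LIMSEQ_imp_Cauchy)
  qed
  have conv: "convergent (\<lambda>n. X (k n) t)" if "a \<le> t" for t
  proof -
    have "Cauchy (\<lambda>n. X (k n) t)"
    proof (rule metric_CauchyI)
      fix e :: real assume e: "0 < e"
      define e' where "e' = e / (3 * (M + 1))"
      have e': "0 < e'" "M * e' < e / 3"
        using e M by (auto simp: e'_def field_simps)
      obtain q where q: "q \<in> S" "\<bar>t - q\<bar> < e'"
        using dense[OF \<open>a \<le> t\<close> e'(1)] by blast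
      obtain N where N: "\<And>m n. m \<ge> N \<Longrightarrow> n \<ge> N \<Longrightarrow> dist (X (k m) q) (X (k n) q) < e / 3"
        using metric_CauchyD[OF conv_S[OF q(1)], of "e / 3"] e by auto
      have close: "dist (X n t) (X n q) < e / 3" for n
      proof -
        have "dist (X n t) (X n q) \<le> M * \<bar>t - q\<bar>"
          using lipD[of q t n] q that by (simp add: dist_norm S_def)
        also have "\<dots> \<le> M * e'"
          using q M by (intro mult_left_mono) auto
        finally show ?thesis using e' by simp
      qed
      have "dist (X (k m) t) (X (k n) t) < e" if "m \<ge> N" "n \<ge> N" for m n
        using close[of "k m"] close[of "k n"] N[OF that]
          dist_triangle[of "X (k m) t" "X (k n) t" "X (k m) q"]
          dist_triangle[of "X (k m) q" "X (k n) t" "X (k n) q"]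
        by (simp add: dist_commute)
      then show "\<exists>N. \<forall>m\<ge>N. \<forall>n\<ge>N. dist (X (k m) t) (X (k n) t) < e"
        by blast
    qed
    then show ?thesis
      by (simp add: Cauchy_convergent_iff)
  qed
  define x where "x t = lim (\<lambda>n. X (k n) t)" for t
  have lim: "(\<lambda>n. X (k n) t) \<longlonglongrightarrow> x t" if "a \<le> t" for t
    using conv[OF that] by (simp add: x_def convergent_LIMSEQ_iff)
  have "M-lipschitz_on {a..} x"
  proof (rule lipschitz_onI)
    fix s t assume st: "s \<in> {a..}" "t \<in> {a..}"
    have "(\<lambda>n. dist (X (k n) s) (X (k n) t)) \<longlonglongrightarrow> dist (x s) (x t)"
      using st by (intro tendsto_dist lim) auto
    then show "dist (x s) (x t) \<le> M * dist s t"
      by (rule LIMSEQ_le_const2) (use lipschitz_onD[OF lip] st in blast)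
  qed (fact M)
  then show thesis
    using that k(1) lim by blast
qed

text \<open>\<open>f\<close> may be discontinuous outside \<open>U\<close>: up to the first exit time the Euler polygons
  converge to points of \<open>U\<close>.\<close>

lemma peano_exists_until_exit:
  fixes f :: "'a::euclidean_space \<Rightarrow> 'a" and a :: real
  assumes U: "open U" and cont: "continuous_on U f" and bound: "\<And>z. norm (f z) \<le> M"
  obtains x where "x a = x0" "continuous_on {a..} x"
    "\<And>t. \<lbrakk>a \<le> t; \<And>s. \<lbrakk>a \<le> s; s < t\<rbrakk> \<Longrightarrow> x s \<in> U\<rbrakk> \<Longrightarrow>
      ((\<lambda>s. f (x s)) has_integral x t - x0) {a..t}"
proof -
  have M: "0 \<le> M"
    using bound norm_ge_zero order_trans by blast
  define h where "h n = 1 / real (Suc n)" for n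
  define p where "p n s = a + h n * of_int \<lfloor>(s - a) / h n\<rfloor>" for n s
  have h: "0 < h n" for n
    by (simp add: h_def)
  have "\<forall>n. \<exists>X. X a = x0 \<and> (\<forall>t\<ge>a. ((\<lambda>s. f (X (p n s))) has_integral X t - x0) {a..t})"
    unfolding p_def using euler_polygon_exists[where f = f, OF h bound] by metis
  then obtain X where X: "\<And>n. X n a = x0"
    "\<And>n t. a \<le> t \<Longrightarrow> ((\<lambda>s. f (X n (p n s))) has_integral X n t - x0) {a..t}"
    by metis
  have lip: "M-lipschitz_on {a..} (X n)" for n
  proof (rule lipschitz_onI)
    have le: "norm (X n t - X n s) \<le> M * (t - s)" if "a \<le> s" "s \<le> t" for s t
    proof -
      let ?g = "\<lambda>s. f (X n (p n s))"
      have "?g integrable_on {a..t}"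
        using X(2)[of t n] that by auto
      then have "?g integrable_on {s..t}"
        by (rule integrable_subinterval_real) (use that in auto)
      then have "norm (integral {s..t} ?g) \<le> M * (t - s)"
        using has_integral_bound_real[OF M finite.emptyI, of ?g "integral {s..t} ?g" s t]
          bound that by (auto simp: has_integral_integral)
      moreover have "integral {a..s} ?g + integral {s..t} ?g = integral {a..t} ?g"
        by (rule Henstock_Kurzweil_Integration.integral_combine) (use that X(2)[of t n] in auto)
      moreover have "integral {a..s} ?g = X n s - x0" "integral {a..t} ?g = X n t - x0"
        using X(2)[of s n] X(2)[of t n] that by (simp_all add: integral_unique)
      ultimately show ?thesis
        by (smt (verit) add_diff_cancel_left' diff_diff_eq2 diff_add_cancel)
    qed
    fix s t assume "s \<in> {a..}" "t \<in> {a..}"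
    then show "dist (X n s) (X n t) \<le> M * dist s t"
      using le[of s t] le[of t s] by (cases "s \<le> t") (auto simp: dist_norm norm_minus_commute)
  qed (fact M)
  obtain k x where k: "strict_mono k" and lim: "\<And>t. a \<le> t \<Longrightarrow> (\<lambda>n. X (k n) t) \<longlonglongrightarrow> x t"
    and lipx: "M-lipschitz_on {a..} x"
    using lipschitz_sequence_convergent_subseq[where X = X, OF X(1) lip] by metis
  have p: "a \<le> p n s" "\<bar>p n s - s\<bar> \<le> h n" if "a \<le> s" for n s
  proof -
    let ?m = "of_int \<lfloor>(s - a) / h n\<rfloor> :: real"
    have "0 \<le> ?m"
      using that h[of n] by simp
    then show "a \<le> p n s"
      using h[of n] by (simp add: p_def)
    have "?m * h n \<le> s - a" "s - a \<le> (?m + 1) * h n"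
      by (simp_all add: pos_le_divide_eq[symmetric] pos_divide_le_eq[symmetric] h)
    then show "\<bar>p n s - s\<bar> \<le> h n"
      by (simp add: p_def algebra_simps abs_le_iff)
  qed
  \<comment> \<open>The polygons sampled at the delayed grid times have the same limit, because the
    delay is at most \<open>h (k n)\<close> and the Lipschitz constant is common to all of
    them.\<close>
  have lim_p: "(\<lambda>n. X (k n) (p (k n) s)) \<longlonglongrightarrow> x s" if "a \<le> s" for s
  proof -
    have "(\<lambda>n. X (k n) (p (k n) s) - X (k n) s) \<longlonglongrightarrow> 0"
    proof (rule Lim_null_comparison)
      show "\<forall>\<^sub>F n in sequentially. norm (X (k n) (p (k n) s) - X (k n) s) \<le> M * h (k n)"
      proof (rule always_eventually, rule allI)
        fix n
        have "norm (X (k n) (p (k n) s) - X (k n) s) \<le> M * \<bar>p (k n) s - s\<bar>"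
          using lipschitz_onD[OF lip, of "p (k n) s" s "k n"] p(1)[OF that] that
          by (simp add: dist_norm)
        also have "\<dots> \<le> M * h (k n)"
          using p(2)[OF that] M by (intro mult_left_mono)
        finally show "norm (X (k n) (p (k n) s) - X (k n) s) \<le> M * h (k n)" .
      qed
      have "h \<longlonglongrightarrow> 0"
        unfolding h_def using lim_inverse_n' LIMSEQ_Suc by fast
      then have "(\<lambda>n. h (k n)) \<longlonglongrightarrow> 0"
        using LIMSEQ_subseq_LIMSEQ[OF _ k] by (simp add: o_def)
      then show "(\<lambda>n. M * h (k n)) \<longlonglongrightarrow> 0"
        by (rule tendsto_mult_right_zero)
    qed
    from tendsto_add[OF this lim[OF that]] show ?thesis by simp
  qed
  show thesis
  proof (rule that)
    show "x a = x0"
      using lim[of a] by (simp add: X(1) LIMSEQ_const_iff)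
    show "continuous_on {a..} x"
      by (rule lipschitz_on_continuous_on[OF lipx])
    fix t assume t: "a \<le> t" and stay: "\<And>s. \<lbrakk>a \<le> s; s < t\<rbrakk> \<Longrightarrow> x s \<in> U"
    \<comment> \<open>The end point \<open>x t\<close> may already lie outside \<open>U\<close>,
      where \<open>f\<close> need not be continuous. Overwriting the integrand at this one time
      gives convergence on the whole interval without changing the integrals.\<close>
    let ?g = "\<lambda>n s. if s = t then f (x t) else f (X (k n) (p (k n) s))"
    show "((\<lambda>s. f (x s)) has_integral x t - x0) {a..t}"
    proof (rule has_integral_dominated_convergence[where f = ?g and h = "\<lambda>_. M"])
      show "(?g n has_integral X (k n) t - x0) {a..t}" for n
        by (rule has_integral_spike_finite[of "{t}", OF _ _ X(2)[OF t]]) auto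
      show "\<forall>s\<in>{a..t}. (\<lambda>n. ?g n s) \<longlonglongrightarrow> f (x s)"
      proof
        fix s assume s: "s \<in> {a..t}"
        show "(\<lambda>n. ?g n s) \<longlonglongrightarrow> f (x s)"
        proof (cases "s = t")
          case False
          then have "isCont f (x s)"
            using s stay[of s] cont U by (simp add: continuous_on_eq_continuous_at)
          from isCont_tendsto_compose[OF this lim_p[of s]] s
          have "(\<lambda>n. f (X (k n) (p (k n) s))) \<longlonglongrightarrow> f (x s)"
            by simp
          then show ?thesis
            using False by simp
        qed simp
      qed
      show "(\<lambda>n. X (k n) t - x0) \<longlonglongrightarrow> x t - x0"
        by (intro tendsto_intros lim t)
    qed (auto simp: bound)
  qed
qed

section \<open>Lipschitz policies and plays\<close>

text \<open>In the numerator of \<open>sgn u - sgn v\<close> over \<open>norm u\<close>, both terms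
  have norm at most \<open>norm (u - v)\<close>. The estimate serves twice below: for the line of
  sight, and for the normalisation in the policies.\<close>

lemma sgn_lipschitz_on:
  fixes r :: real
  assumes "0 < r"
  shows "(2 / r)-lipschitz_on {v::'a::real_normed_vector. r \<le> norm v} sgn"
proof (rule lipschitz_onI)
  fix u v :: 'a
  assume "u \<in> {v. r \<le> norm v}" "v \<in> {v. r \<le> norm v}"
  then have u: "r \<le> norm u" and v: "v \<noteq> 0" and pos: "0 < norm u"
    using assms by auto
  have "sgn u - sgn v = (1 / norm u) *\<^sub>R ((u - v) + (norm v - norm u) *\<^sub>R sgn v)"
  proof -
    have "norm v *\<^sub>R sgn v = v"
      using v by (simp add: sgn_div_norm)
    then have "(u - v) + (norm v - norm u) *\<^sub>R sgn v = u - norm u *\<^sub>R sgn v"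
      by (simp add: scaleR_diff_left)
    then show ?thesis
      using pos by (simp only: scaleR_diff_right sgn_div_norm[of u] scaleR_scaleR) (simp add: divide_inverse)
  qed
  also have "norm \<dots> = norm ((u - v) + (norm v - norm u) *\<^sub>R sgn v) / norm u"
    by simp
  also have "\<dots> \<le> (norm (u - v) + \<bar>norm v - norm u\<bar>) / norm u"
    using v by (intro divide_right_mono norm_triangle_le) (auto simp: norm_sgn)
  also have "\<dots> \<le> (2 * norm (u - v)) / r"
    using u assms norm_triangle_ineq3[of v u]
    by (intro frac_le) (auto simp: norm_minus_commute)
  finally show "dist (sgn u) (sgn v) \<le> 2 / r * dist u v"
    by (simp add: dist_norm)
qed (use assms in simp)

section \<open>Candidate optimal policies and the height of the lowest intercept point\<close>

definition line_of_sight :: "state \<Rightarrow> real^2" where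
  "line_of_sight s = sgn (snd s - fst s)"

text \<open>This policy and the next both head straight for the lowest point of the current
  Apollonius circle. With \<open>e\<close> the line of sight and \<open>y\<close> the upward unit
  vector, it lies in direction \<open>\<nu> e - y\<close> from the defender and
  \<open>e - \<nu> y\<close> from the attacker.\<close>

definition defender_policy :: "real \<Rightarrow> policy" where
  "defender_policy \<nu> s = sgn (\<nu> *\<^sub>R line_of_sight s - axis 2 1)"

definition attacker_policy :: "real \<Rightarrow> policy" where
  "attacker_policy \<nu> s = sgn (line_of_sight s - \<nu> *\<^sub>R axis 2 1)"

definition lowest_intercept :: "real \<Rightarrow> state \<Rightarrow> real" where
  "lowest_intercept \<nu> s =
     apollonius_center (snd s) (fst s) \<nu> $ 2 - apollonius_radius (snd s) (fst s) \<nu>"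

text \<open>Clearing the denominator leaves a linear function of the positions plus a multiple of
  their distance, which is the shape of \<open>potential\<close> below.\<close>

lemma lowest_intercept_eq:
  assumes "1 < \<nu>"
  shows "(\<nu>\<^sup>2 - 1) * lowest_intercept \<nu> s =
    \<nu>\<^sup>2 * snd s $ 2 - fst s $ 2 - \<nu> * norm (snd s - fst s)"
proof -
  define K where "K = \<nu>\<^sup>2 - 1"
  have "0 < K"
    using assms by (simp add: K_def one_less_power)
  then show ?thesis
    unfolding lowest_intercept_def apollonius_center_def apollonius_radius_def K_def[symmetric]
    by (simp add: right_diff_distrib)
qed

lemma terminal_set_iff: "s \<in> terminal_set \<longleftrightarrow> snd s $ 2 = 0 \<or> snd s = fst s"
  by (auto simp: terminal_set_def target_set_def capture_set_def)

lemma norm_line_of_sight: "s \<notin> terminal_set \<Longrightarrow> norm (line_of_sight s) = 1"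
  by (auto simp: line_of_sight_def norm_sgn terminal_set_iff)

lemma closed_terminal_set: "closed terminal_set"
proof -
  have "terminal_set = {s. snd s $ 2 = 0} \<union> {s. snd s = fst s}"
    using terminal_set_iff by auto
  also have "closed \<dots>"
    by (intro closed_Un closed_Collect_eq continuous_intros)
  finally show ?thesis .
qed

text \<open>Both normalisations act away from zero. Near a non-terminal state the distance of the
  players is bounded below, and since the line of sight is a unit vector,
  \<open>a *\<^sub>R line_of_sight s - b\<close> has norm at least the difference of
  \<open>\<bar>a\<bar>\<close> and \<open>norm b\<close>. Both candidate policies have this
  form.\<close>

lemma lipschitz_policy_sgn_line_of_sight:
  fixes b :: "real^2"
  assumes "\<bar>a\<bar> \<noteq> norm b"
  shows "lipschitz_policy (\<lambda>s. sgn (a *\<^sub>R line_of_sight s - b))"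
  unfolding lipschitz_policy_def local_lipschitz_def
proof (intro conjI ballI)
  show "range (\<lambda>s. sgn (a *\<^sub>R line_of_sight s - b)) \<subseteq> controls"
    by (auto simp: controls_def norm_sgn)
  fix s :: state and t :: real
  assume s: "s \<in> - terminal_set"
  \<comment> \<open>The relative position is 2-Lipschitz in the state, so on a ball of radius
    \<open>r / 2\<close> the distance \<open>2 * r\<close> shrinks by at most
    \<open>r\<close>.\<close>
  define r where "r = norm (snd s - fst s) / 2"
  have r: "0 < r"
    using s by (simp add: r_def terminal_set_iff)
  let ?S = "cball s (r / 2) \<inter> - terminal_set"
  let ?w = "\<lambda>z::state. snd z - fst z"
  define m where "m = \<bar>\<bar>a\<bar> - norm b\<bar>"
  have m: "0 < m"
    using assms by (simp add: m_def)
  have dist_w: "dist (?w y) (?w z) \<le> 2 * dist y z" for y z :: state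
  proof -
    have "dist (?w y) (?w z) \<le> dist (snd y) (snd z) + dist (fst y) (fst z)"
      using norm_triangle_ineq4[of "snd y - snd z" "fst y - fst z"]
      by (simp add: dist_norm algebra_simps)
    then show ?thesis
      using dist_fst_le[of y z] dist_snd_le[of y z] by linarith
  qed
  have far: "r \<le> norm (?w z)" if "z \<in> ?S" for z
  proof -
    have "norm (?w s) - norm (?w z) \<le> 2 * (r / 2)"
      using dist_w[of s z] norm_triangle_ineq2[of "?w s" "?w z"] that by (simp add: dist_norm)
    then show ?thesis by (simp add: r_def)
  qed
  have "2-lipschitz_on ?S ?w"
    by (rule lipschitz_onI) (use dist_w in auto)
  then have "(2 / r * 2)-lipschitz_on ?S (sgn \<circ> ?w)"
    by (rule lipschitz_on_compose) (rule lipschitz_on_subset[OF sgn_lipschitz_on[OF r]], use far in auto)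
  then have e: "(2 / r * 2)-lipschitz_on ?S line_of_sight"
    by (simp add: line_of_sight_def o_def)
  have "(\<bar>a\<bar> * (2 / r * 2))-lipschitz_on ?S (\<lambda>z. a *\<^sub>R line_of_sight z - b)"
  proof (rule lipschitz_onI)
    fix y z assume "y \<in> ?S" "z \<in> ?S"
    then have "\<bar>a\<bar> * dist (line_of_sight y) (line_of_sight z) \<le> \<bar>a\<bar> * (2 / r * 2 * dist y z)"
      by (intro mult_left_mono lipschitz_onD[OF e]) auto
    then show "dist (a *\<^sub>R line_of_sight y - b) (a *\<^sub>R line_of_sight z - b)
        \<le> \<bar>a\<bar> * (2 / r * 2) * dist y z"
      by (simp add: dist_norm scaleR_diff_right[symmetric] mult.assoc)
  qed (use r in simp)
  moreover have "m \<le> norm (a *\<^sub>R line_of_sight z - b)" if "z \<in> ?S" for z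
    using norm_triangle_ineq3[of "a *\<^sub>R line_of_sight z" b] norm_line_of_sight[of z] that
    by (simp add: m_def)
  ultimately have "(2 / m * (\<bar>a\<bar> * (2 / r * 2)))-lipschitz_on ?S
      (sgn \<circ> (\<lambda>z. a *\<^sub>R line_of_sight z - b))"
    by (intro lipschitz_on_compose) (auto intro: lipschitz_on_subset[OF sgn_lipschitz_on[OF m]])
  then show "\<exists>u>0. \<exists>L. \<forall>t'\<in>cball t u \<inter> UNIV.
      L-lipschitz_on (cball s u \<inter> - terminal_set) (\<lambda>s. sgn (a *\<^sub>R line_of_sight s - b))"
    using r by (intro exI[of _ "r / 2"]) (auto simp: o_def)
qed

lemma lipschitz_defender_policy: "1 < \<nu> \<Longrightarrow> lipschitz_policy (defender_policy \<nu>)"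
  using lipschitz_policy_sgn_line_of_sight[of \<nu> "axis 2 1"]
  unfolding defender_policy_def[abs_def] by simp

lemma lipschitz_attacker_policy: "1 < \<nu> \<Longrightarrow> lipschitz_policy (attacker_policy \<nu>)"
  using lipschitz_policy_sgn_line_of_sight[of 1 "\<nu> *\<^sub>R axis 2 1"]
  unfolding attacker_policy_def[abs_def] by simp

section \<open>Existence of plays and the final time\<close>

lemma lipschitz_policy_continuous_on:
  "lipschitz_policy \<gamma> \<Longrightarrow> continuous_on (- terminal_set) \<gamma>"
  unfolding lipschitz_policy_def using local_lipschitz_continuous_on by blast

lemma norm_policy_le: "range \<gamma> \<subseteq> controls \<Longrightarrow> norm (\<gamma> s) \<le> 1"
  by (auto simp: controls_def)

lemma norm_play_field_le:
  assumes "range \<gamma>\<^sub>D \<subseteq> controls" "range \<gamma>\<^sub>A \<subseteq> controls"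
  shows "norm (v\<^sub>D *\<^sub>R \<gamma>\<^sub>D s, v\<^sub>A *\<^sub>R \<gamma>\<^sub>A s) \<le> \<bar>v\<^sub>D\<bar> + \<bar>v\<^sub>A\<bar>"
proof -
  have "norm (v\<^sub>D *\<^sub>R \<gamma>\<^sub>D s, v\<^sub>A *\<^sub>R \<gamma>\<^sub>A s) \<le> \<bar>v\<^sub>D\<bar> * norm (\<gamma>\<^sub>D s) + \<bar>v\<^sub>A\<bar> * norm (\<gamma>\<^sub>A s)"
    using norm_Pair_le[of "v\<^sub>D *\<^sub>R \<gamma>\<^sub>D s" "v\<^sub>A *\<^sub>R \<gamma>\<^sub>A s"] by simp
  also have "\<dots> \<le> \<bar>v\<^sub>D\<bar> * 1 + \<bar>v\<^sub>A\<bar> * 1"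
    by (intro add_mono mult_left_mono norm_policy_le assms) auto
  finally show ?thesis by simp
qed

lemma play_exists:
  assumes D: "lipschitz_policy \<gamma>\<^sub>D" and A: "lipschitz_policy \<gamma>\<^sub>A"
  shows "\<exists>x. play v\<^sub>D v\<^sub>A t\<^sub>s x0 \<gamma>\<^sub>D \<gamma>\<^sub>A x"
proof -
  let ?f = "\<lambda>s. (v\<^sub>D *\<^sub>R \<gamma>\<^sub>D s, v\<^sub>A *\<^sub>R \<gamma>\<^sub>A s)"
  have "open (- terminal_set)"
    using closed_terminal_set by (simp add: open_Compl)
  moreover have "continuous_on (- terminal_set) ?f"
    by (intro continuous_intros lipschitz_policy_continuous_on D A)
  moreover have "norm (?f s) \<le> \<bar>v\<^sub>D\<bar> + \<bar>v\<^sub>A\<bar>" for s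
    using D A by (intro norm_play_field_le) (auto simp: lipschitz_policy_def)
  ultimately obtain x where x: "x t\<^sub>s = x0" "continuous_on {t\<^sub>s..} x"
    "\<And>t. \<lbrakk>t\<^sub>s \<le> t; \<And>s. \<lbrakk>t\<^sub>s \<le> s; s < t\<rbrakk> \<Longrightarrow> x s \<in> - terminal_set\<rbrakk> \<Longrightarrow>
      ((\<lambda>s. ?f (x s)) has_integral x t - x0) {t\<^sub>s..t}"
    using peano_exists_until_exit[where f = ?f and a = t\<^sub>s and ?x0.0 = x0] by blast
  have "play v\<^sub>D v\<^sub>A t\<^sub>s x0 \<gamma>\<^sub>D \<gamma>\<^sub>A x"
    unfolding play_def
  proof (intro conjI ballI x(1,2))
    fix t assume "t \<in> running_times t\<^sub>s x"
    then have int: "((\<lambda>s. ?f (x s)) has_integral x t - x0) {t\<^sub>s..t}"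
      by (intro x(3)) (auto simp: running_times_def)
    from has_integral_linear[OF this bounded_linear_fst]
    show "((\<lambda>s. v\<^sub>D *\<^sub>R \<gamma>\<^sub>D (x s)) has_integral (fst (x t) - fst x0)) {t\<^sub>s..t}"
      by (simp add: o_def)
    from has_integral_linear[OF int bounded_linear_snd]
    show "((\<lambda>s. v\<^sub>A *\<^sub>R \<gamma>\<^sub>A (x s)) has_integral (snd (x t) - snd x0)) {t\<^sub>s..t}"
      by (simp add: o_def)
  qed
  then show ?thesis by blast
qed

text \<open>The terminal times form a closed set by continuity. As \<open>running_times\<close>
  excludes terminal states only strictly before \<open>t\<close>, the integral equations remain
  available at the final time itself.\<close>

lemma final_time_attained:
  assumes "continuous_on {t\<^sub>s..} x" "terminates t\<^sub>s x"
  shows "final_time t\<^sub>s x \<in> running_times t\<^sub>s x" "x (final_time t\<^sub>s x) \<in> terminal_set"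
proof -
  let ?E = "{t. t\<^sub>s \<le> t \<and> x t \<in> terminal_set}"
  have "closed ({t\<^sub>s..} \<inter> x -` terminal_set)"
    using assms(1) closed_terminal_set by (intro continuous_closed_preimage) auto
  moreover have "?E = {t\<^sub>s..} \<inter> x -` terminal_set"
    by auto
  ultimately have "closed ?E"
    by simp
  moreover have bdd: "bdd_below ?E"
    by (auto intro: bdd_belowI[of _ t\<^sub>s])
  moreover have "?E \<noteq> {}"
    using assms(2) by (auto simp: terminates_def)
  ultimately have "Inf ?E \<in> ?E"
    by (intro closed_contains_Inf)
  moreover have "t \<notin> ?E" if "t < Inf ?E" for t
    using cInf_lower[OF _ bdd, of t] that by auto
  ultimately show "final_time t\<^sub>s x \<in> running_times t\<^sub>s x" "x (final_time t\<^sub>s x) \<in> terminal_set"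
    by (auto simp: final_time_def running_times_def)
qed

lemma mem_running_times_if_not_terminates:
  "\<lbrakk>\<not> terminates t\<^sub>s x; t\<^sub>s \<le> t\<rbrakk> \<Longrightarrow> t \<in> running_times t\<^sub>s x"
  by (auto simp: terminates_def running_times_def)

text \<open>One family covers every function followed along plays: the lowest intercept height with
  either sign (scaled by \<open>\<nu>\<^sup>2 - 1\<close>), the quantity that forces capture or
  arrival, and the height of the attacker. With \<open>e\<close> the line of sight, its gradient is
  \<open>a e + p\<close> in the attacker's position and \<open>q - a e\<close> in the
  defender's.\<close>

definition potential :: "real \<Rightarrow> real^2 \<Rightarrow> real^2 \<Rightarrow> state \<Rightarrow> real" where
  "potential a p q s = a * norm (snd s - fst s) + p \<bullet> snd s + q \<bullet> fst s"

lemma potential_along_play: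
  assumes play: "play v\<^sub>D v\<^sub>A t\<^sub>s x0 \<gamma>\<^sub>D \<gamma>\<^sub>A x" and T: "T \<in> running_times t\<^sub>s x"
    and range: "range \<gamma>\<^sub>D \<subseteq> controls" "range \<gamma>\<^sub>A \<subseteq> controls"
    and rate: "\<And>s e. \<lbrakk>s \<notin> terminal_set; 0 < e\<rbrakk> \<Longrightarrow> \<forall>\<^sub>F z in nhds s.
      v\<^sub>A * ((a *\<^sub>R line_of_sight s + p) \<bullet> \<gamma>\<^sub>A z) + v\<^sub>D * ((q - a *\<^sub>R line_of_sight s) \<bullet> \<gamma>\<^sub>D z) \<le> c + e"
  shows "potential a p q (x T) \<le> potential a p q x0 + c * (T - t\<^sub>s)"
proof -
  have x: "x t\<^sub>s = x0" "continuous_on {t\<^sub>s..} x"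
    and int: "\<And>t. t \<in> running_times t\<^sub>s x \<Longrightarrow>
        ((\<lambda>s. v\<^sub>D *\<^sub>R \<gamma>\<^sub>D (x s)) has_integral (fst (x t) - fst x0)) {t\<^sub>s..t} \<and>
        ((\<lambda>s. v\<^sub>A *\<^sub>R \<gamma>\<^sub>A (x s)) has_integral (snd (x t) - snd x0)) {t\<^sub>s..t}"
    using play by (auto simp: play_def)
  have run: "t \<in> running_times t\<^sub>s x" if "t \<in> {t\<^sub>s..T}" for t
    using T that by (auto simp: running_times_def)
  have nt: "x t \<notin> terminal_set" if "t\<^sub>s \<le> t" "t < T" for t
    using T that by (auto simp: running_times_def)
  let ?f = "\<lambda>s. (v\<^sub>D *\<^sub>R \<gamma>\<^sub>D s, v\<^sub>A *\<^sub>R \<gamma>\<^sub>A s)"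
  let ?F' = "\<lambda>s h. a * (line_of_sight s \<bullet> (snd h - fst h)) + p \<bullet> snd h + q \<bullet> fst h"
  have "potential a p q (x T) \<le> potential a p q (x t\<^sub>s) + c * (T - t\<^sub>s)"
  proof (rule integral_curve_upper_bound[where f = ?f and F' = "\<lambda>t. ?F' (x t)"])
    show "t\<^sub>s \<le> T"
      using T by (simp add: running_times_def)
    show "continuous_on {t\<^sub>s..T} x"
      by (rule continuous_on_subset[OF x(2)]) auto
    show "((\<lambda>s. ?f (x s)) has_integral x t - x t\<^sub>s) {t\<^sub>s..t}" if "t \<in> {t\<^sub>s..T}" for t
    proof -
      have "((\<lambda>s. ?f (x s)) has_integral (fst (x t) - fst x0, snd (x t) - snd x0)) {t\<^sub>s..t}"
        using has_integral_add[OF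
            has_integral_linear[OF _ bounded_linear_Pair[OF bounded_linear_ident bounded_linear_zero]]
            has_integral_linear[OF _ bounded_linear_Pair[OF bounded_linear_zero bounded_linear_ident]]]
          int[OF run[OF that]]
        by (auto simp: o_def)
      then show ?thesis
        by (simp add: x(1) minus_prod_def)
    qed
    show "norm (?f z) \<le> \<bar>v\<^sub>D\<bar> + \<bar>v\<^sub>A\<bar>" for z
      by (rule norm_play_field_le[OF range])
    show "continuous_on UNIV (potential a p q)"
      unfolding potential_def[abs_def] by (intro continuous_intros)
    show "(potential a p q has_derivative ?F' (x t)) (at (x t))" if "t\<^sub>s \<le> t" "t < T" for t
    proof -
      have "snd (x t) - fst (x t) \<noteq> 0"
        using nt[OF that] by (simp add: terminal_set_iff)
      moreover have "((\<lambda>s. snd s - fst s) has_derivative (\<lambda>h. snd h - fst h)) (at (x t))"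
        by (intro derivative_intros)
      ultimately have "((\<lambda>s. norm (snd s - fst s)) has_derivative
          (\<lambda>h. line_of_sight (x t) \<bullet> (snd h - fst h))) (at (x t))"
        using has_derivative_compose[OF _ has_derivative_norm]
        by (fastforce simp: line_of_sight_def inner_commute)
      then show ?thesis
        unfolding potential_def[abs_def] by (intro derivative_intros)
    qed
    show "\<forall>\<^sub>F z in nhds (x t). ?F' (x t) (?f z) \<le> c + e" if "t\<^sub>s \<le> t" "t < T" "0 < e" for t e
      using rate[OF nt[OF that(1,2)] that(3)]
      by eventually_elim (simp add: inner_simps algebra_simps)
  qed
  then show ?thesis by (simp add: x(1))
qed

section \<open>Optimal policies\<close>

lemma inner_sgn_self: "v \<bullet> sgn v = norm (v::'a::real_inner)"
  by (cases "v = 0") (simp_all add: sgn_div_norm power2_norm_eq_inner[symmetric] power2_eq_square)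

text \<open>Both squares equal \<open>a\<^sup>2 - 2 * a * (e \<bullet> y) + 1\<close>. Together with
  \<open>v\<^sub>D = \<nu> * v\<^sub>A\<close> this makes the optimal contributions of the two
  players cancel.\<close>

lemma norm_scaleR_diff_swap:
  fixes e y :: "'a::real_inner"
  assumes "norm e = 1" "norm y = 1"
  shows "norm (a *\<^sub>R e - y) = norm (e - a *\<^sub>R y)"
proof -
  have "e \<bullet> e = 1" "y \<bullet> y = 1"
    using assms by (simp_all add: power2_norm_eq_inner[symmetric])
  then show ?thesis
    by (simp add: norm_eq_sqrt_inner inner_diff_left inner_diff_right inner_commute algebra_simps)
qed

text \<open>Reduces a rate along plays to a static inequality over unit vectors. The attacker's
  feedback may be discontinuous, so its term is bounded at every nearby state by Cauchy-Schwarz; the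
  defender's is continuous off the terminal set and changes by at most the slack.\<close>

lemma potential_against_defender_policy:
  assumes play: "play v\<^sub>D v\<^sub>A t\<^sub>s x0 (defender_policy \<nu>) \<gamma>\<^sub>A x" and T: "T \<in> running_times t\<^sub>s x"
    and A: "range \<gamma>\<^sub>A \<subseteq> controls" and "1 < \<nu>" "0 < v\<^sub>A"
    and c: "\<And>e. norm e = 1 \<Longrightarrow>
      v\<^sub>A * norm (a *\<^sub>R e + p) + v\<^sub>D * ((q - a *\<^sub>R e) \<bullet> sgn (\<nu> *\<^sub>R e - axis 2 1)) \<le> c"
  shows "potential a p q (x T) \<le> potential a p q x0 + c * (T - t\<^sub>s)"
proof (rule potential_along_play[OF play T _ A])
  have D: "lipschitz_policy (defender_policy \<nu>)"
    by (rule lipschitz_defender_policy) fact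
  then show "range (defender_policy \<nu>) \<subseteq> controls"
    by (simp add: lipschitz_policy_def)
  fix s :: state and e :: real assume s: "s \<notin> terminal_set" and e: "0 < e"
  let ?l = "line_of_sight s"
  have "isCont (defender_policy \<nu>) s"
    using lipschitz_policy_continuous_on[OF D] closed_terminal_set s
    by (simp add: continuous_on_eq_continuous_at open_Compl)
  then have "((\<lambda>z. v\<^sub>D * ((q - a *\<^sub>R ?l) \<bullet> defender_policy \<nu> z)) \<longlongrightarrow>
      v\<^sub>D * ((q - a *\<^sub>R ?l) \<bullet> defender_policy \<nu> s)) (nhds s)"
    unfolding continuous_at tendsto_at_iff_tendsto_nhds by (intro tendsto_intros)
  then have "\<forall>\<^sub>F z in nhds s. v\<^sub>D * ((q - a *\<^sub>R ?l) \<bullet> defender_policy \<nu> z) <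
      v\<^sub>D * ((q - a *\<^sub>R ?l) \<bullet> defender_policy \<nu> s) + e"
    by (rule order_tendstoD) (use e in simp)
  then show "\<forall>\<^sub>F z in nhds s. v\<^sub>A * ((a *\<^sub>R ?l + p) \<bullet> \<gamma>\<^sub>A z) +
      v\<^sub>D * ((q - a *\<^sub>R ?l) \<bullet> defender_policy \<nu> z) \<le> c + e"
  proof eventually_elim
    case (elim z)
    have "(a *\<^sub>R ?l + p) \<bullet> \<gamma>\<^sub>A z \<le> norm (a *\<^sub>R ?l + p) * norm (\<gamma>\<^sub>A z)"
      by (rule norm_cauchy_schwarz)
    also have "\<dots> \<le> norm (a *\<^sub>R ?l + p) * 1"
      by (intro mult_left_mono norm_policy_le[OF A]) simp
    finally have "v\<^sub>A * ((a *\<^sub>R ?l + p) \<bullet> \<gamma>\<^sub>A z) \<le> v\<^sub>A * norm (a *\<^sub>R ?l + p)"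
      using \<open>0 < v\<^sub>A\<close> by simp
    then show ?case
      using elim c[OF norm_line_of_sight[OF s]] by (simp add: defender_policy_def)
  qed
qed

text \<open>The same reduction with the roles exchanged: Cauchy-Schwarz for the arbitrary defender,
  continuity for the attacker.\<close>

lemma potential_against_attacker_policy:
  assumes play: "play v\<^sub>D v\<^sub>A t\<^sub>s x0 \<gamma>\<^sub>D (attacker_policy \<nu>) x" and T: "T \<in> running_times t\<^sub>s x"
    and D: "range \<gamma>\<^sub>D \<subseteq> controls" and "1 < \<nu>" "0 < v\<^sub>D"
    and c: "\<And>e. norm e = 1 \<Longrightarrow>
      v\<^sub>A * ((a *\<^sub>R e + p) \<bullet> sgn (e - \<nu> *\<^sub>R axis 2 1)) + v\<^sub>D * norm (q - a *\<^sub>R e) \<le> c"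
  shows "potential a p q (x T) \<le> potential a p q x0 + c * (T - t\<^sub>s)"
proof (rule potential_along_play[OF play T D])
  have A: "lipschitz_policy (attacker_policy \<nu>)"
    by (rule lipschitz_attacker_policy) fact
  then show "range (attacker_policy \<nu>) \<subseteq> controls"
    by (simp add: lipschitz_policy_def)
  fix s :: state and e :: real assume s: "s \<notin> terminal_set" and e: "0 < e"
  let ?l = "line_of_sight s"
  have "isCont (attacker_policy \<nu>) s"
    using lipschitz_policy_continuous_on[OF A] closed_terminal_set s
    by (simp add: continuous_on_eq_continuous_at open_Compl)
  then have "((\<lambda>z. v\<^sub>A * ((a *\<^sub>R ?l + p) \<bullet> attacker_policy \<nu> z)) \<longlongrightarrow>
      v\<^sub>A * ((a *\<^sub>R ?l + p) \<bullet> attacker_policy \<nu> s)) (nhds s)"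
    unfolding continuous_at tendsto_at_iff_tendsto_nhds by (intro tendsto_intros)
  then have "\<forall>\<^sub>F z in nhds s. v\<^sub>A * ((a *\<^sub>R ?l + p) \<bullet> attacker_policy \<nu> z) <
      v\<^sub>A * ((a *\<^sub>R ?l + p) \<bullet> attacker_policy \<nu> s) + e"
    by (rule order_tendstoD) (use e in simp)
  then show "\<forall>\<^sub>F z in nhds s. v\<^sub>A * ((a *\<^sub>R ?l + p) \<bullet> attacker_policy \<nu> z) +
      v\<^sub>D * ((q - a *\<^sub>R ?l) \<bullet> \<gamma>\<^sub>D z) \<le> c + e"
  proof eventually_elim
    case (elim z)
    have "(q - a *\<^sub>R ?l) \<bullet> \<gamma>\<^sub>D z \<le> norm (q - a *\<^sub>R ?l) * norm (\<gamma>\<^sub>D z)"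
      by (rule norm_cauchy_schwarz)
    also have "\<dots> \<le> norm (q - a *\<^sub>R ?l) * 1"
      by (intro mult_left_mono norm_policy_le[OF D]) simp
    finally have "v\<^sub>D * ((q - a *\<^sub>R ?l) \<bullet> \<gamma>\<^sub>D z) \<le> v\<^sub>D * norm (q - a *\<^sub>R ?l)"
      using \<open>0 < v\<^sub>D\<close> by simp
    then show ?case
      using elim c[OF norm_line_of_sight[OF s]] by (simp add: attacker_policy_def)
  qed
qed

lemma defender_policy_guarantee:
  assumes play: "play v\<^sub>D v\<^sub>A t\<^sub>s x0 (defender_policy \<nu>) \<gamma>\<^sub>A x"
    and A: "range \<gamma>\<^sub>A \<subseteq> controls" and \<nu>: "1 < \<nu>" and vA: "0 < v\<^sub>A" and vD: "v\<^sub>D = \<nu> * v\<^sub>A"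
  shows "terminates t\<^sub>s x" "max 0 (lowest_intercept \<nu> x0) \<le> payoff t\<^sub>s x"
proof -
  let ?Y = "axis 2 1 :: real^2"
  note bound = potential_against_defender_policy[OF play _ A \<nu> vA]
  have x: "x t\<^sub>s = x0" "continuous_on {t\<^sub>s..} x"
    using play by (auto simp: play_def)
  have sgn: "(?Y - \<nu> *\<^sub>R e) \<bullet> sgn (\<nu> *\<^sub>R e - ?Y) = - norm (\<nu> *\<^sub>R e - ?Y)" for e
    using inner_sgn_self[of "\<nu> *\<^sub>R e - ?Y"] by (simp add: inner_diff_left)
  show ends: "terminates t\<^sub>s x"
  proof (rule ccontr)
    assume "\<not> terminates t\<^sub>s x"
    note run = mem_running_times_if_not_terminates[OF this]
    \<comment> \<open>The potential changes at rate at most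
      \<open>(v\<^sub>A - v\<^sub>D) * norm (\<nu> *\<^sub>R e - ?Y)\<close>, where
      \<open>v\<^sub>A - v\<^sub>D\<close> is \<open>- v\<^sub>A * (\<nu> - 1)\<close> and the norm
      is at least \<open>\<nu> - 1\<close>.\<close>
    define k where "k = v\<^sub>A * (\<nu> - 1)\<^sup>2"
    have k: "0 < k"
      using vA \<nu> by (simp add: k_def)
    have drop: "potential \<nu> (- ?Y) ?Y (x t) \<le> potential \<nu> (- ?Y) ?Y x0 + (- k) * (t - t\<^sub>s)"
      if "t\<^sub>s \<le> t" for t
    proof (rule bound[OF run[OF that]])
      fix e :: "real^2" assume e: "norm e = 1"
      have "\<nu> - 1 \<le> norm (\<nu> *\<^sub>R e - ?Y)"
        using norm_triangle_ineq2[of "\<nu> *\<^sub>R e" ?Y] e \<nu> by simp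
      then have "v\<^sub>A * (\<nu> - 1) * (\<nu> - 1) \<le> v\<^sub>A * (\<nu> - 1) * norm (\<nu> *\<^sub>R e - ?Y)"
        using vA \<nu> by (intro mult_left_mono) auto
      then show "v\<^sub>A * norm (\<nu> *\<^sub>R e + - ?Y) + v\<^sub>D * ((?Y - \<nu> *\<^sub>R e) \<bullet> sgn (\<nu> *\<^sub>R e - ?Y)) \<le> - k"
        unfolding sgn by (simp add: vD k_def power2_eq_square algebra_simps)
    qed
    have nonneg: "0 \<le> potential \<nu> (- ?Y) ?Y s" for s
    proof -
      have "snd s $ 2 - fst s $ 2 \<le> norm (snd s - fst s)"
        using component_le_norm_cart[of "snd s - fst s" 2] by simp
      also have "\<dots> \<le> \<nu> * norm (snd s - fst s)"
        using mult_right_mono[of 1 \<nu> "norm (snd s - fst s)"] \<nu> by simp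
      finally show ?thesis
        by (simp add: potential_def inner_axis')
    qed
    let ?t = "t\<^sub>s + (potential \<nu> (- ?Y) ?Y x0 + 1) / k"
    have "potential \<nu> (- ?Y) ?Y (x ?t) \<le> - 1"
      using drop[of ?t] k nonneg[of x0] by simp
    then show False
      using nonneg[of "x ?t"] by simp
  qed
  let ?T = "final_time t\<^sub>s x"
  note fin = final_time_attained[OF x(2) ends]
  have pos: "0 < \<nu>\<^sup>2 - 1"
    using \<nu> by (simp add: one_less_power)
  have pot: "potential \<nu> (- \<nu>\<^sup>2 *\<^sub>R ?Y) ?Y s = - ((\<nu>\<^sup>2 - 1) * lowest_intercept \<nu> s)" for s
    by (simp add: lowest_intercept_eq[OF \<nu>] potential_def inner_axis')
  \<comment> \<open>The attacker contributes at most
    \<open>v\<^sub>A * \<nu> * norm (e - \<nu> *\<^sub>R ?Y)\<close> and the defender exactly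
    \<open>- v\<^sub>D * norm (\<nu> *\<^sub>R e - ?Y)\<close>; these cancel, so the rate is
    \<open>0\<close>.\<close>
  have "potential \<nu> (- \<nu>\<^sup>2 *\<^sub>R ?Y) ?Y (x ?T) \<le> potential \<nu> (- \<nu>\<^sup>2 *\<^sub>R ?Y) ?Y x0 + 0 * (?T - t\<^sub>s)"
  proof (rule bound[OF fin(1)])
    fix e :: "real^2" assume e: "norm e = 1"
    have "\<nu> *\<^sub>R e + - \<nu>\<^sup>2 *\<^sub>R ?Y = \<nu> *\<^sub>R (e - \<nu> *\<^sub>R ?Y)"
      by (simp add: scaleR_diff_right power2_eq_square)
    then have "norm (\<nu> *\<^sub>R e + - \<nu>\<^sup>2 *\<^sub>R ?Y) = \<nu> * norm (\<nu> *\<^sub>R e - ?Y)"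
      using norm_scaleR_diff_swap[OF e, of ?Y \<nu>] \<nu> by simp
    then show "v\<^sub>A * norm (\<nu> *\<^sub>R e + - \<nu>\<^sup>2 *\<^sub>R ?Y) +
        v\<^sub>D * ((?Y - \<nu> *\<^sub>R e) \<bullet> sgn (\<nu> *\<^sub>R e - ?Y)) \<le> 0"
      by (simp only: sgn vD) simp
  qed
  then have low: "lowest_intercept \<nu> x0 \<le> lowest_intercept \<nu> (x ?T)"
    using pos unfolding pot by simp
  show "max 0 (lowest_intercept \<nu> x0) \<le> payoff t\<^sub>s x"
  proof (cases "snd (x ?T) = fst (x ?T)")
    case True
    then have "(\<nu>\<^sup>2 - 1) * lowest_intercept \<nu> (x ?T) = (\<nu>\<^sup>2 - 1) * snd (x ?T) $ 2"
      unfolding lowest_intercept_eq[OF \<nu>] by (simp add: algebra_simps)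
    then show ?thesis
      using low pos by (simp add: payoff_def)
  next
    case False
    then have 0: "snd (x ?T) $ 2 = 0"
      using fin(2) by (simp add: terminal_set_iff)
    \<comment> \<open>The payoff is \<open>0\<close> here, so the initial intercept height has to be
      nonpositive. It is at most the final one, which is nonpositive because the defender is below
      the line by at most the distance to the attacker.\<close>
    have "- fst (x ?T) $ 2 \<le> norm (snd (x ?T) - fst (x ?T))"
      using component_le_norm_cart[of "snd (x ?T) - fst (x ?T)" 2] 0 by simp
    also have "\<dots> \<le> \<nu> * norm (snd (x ?T) - fst (x ?T))"
      using mult_right_mono[of 1 \<nu> "norm (snd (x ?T) - fst (x ?T))"] \<nu> by simp
    finally have "(\<nu>\<^sup>2 - 1) * lowest_intercept \<nu> (x ?T) \<le> 0"
      by (simp add: lowest_intercept_eq[OF \<nu>] 0)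
    then show ?thesis
      using low pos by (simp add: payoff_def mult_le_0_iff)
  qed
qed

lemma attacker_policy_guarantee:
  assumes play: "play v\<^sub>D v\<^sub>A t\<^sub>s x0 \<gamma>\<^sub>D (attacker_policy \<nu>) x"
    and D: "range \<gamma>\<^sub>D \<subseteq> controls" and \<nu>: "1 < \<nu>" and vA: "0 < v\<^sub>A" and vD: "v\<^sub>D = \<nu> * v\<^sub>A"
    and x0: "0 \<le> snd x0 $ 2"
  shows "terminates t\<^sub>s x" "payoff t\<^sub>s x \<le> max 0 (lowest_intercept \<nu> x0)"
proof -
  let ?Y = "axis 2 1 :: real^2"
  have vD0: "0 < v\<^sub>D"
    using \<nu> vA vD by simp
  note bound = potential_against_attacker_policy[OF play _ D \<nu> vD0]
  have x: "x t\<^sub>s = x0" "continuous_on {t\<^sub>s..} x"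
    using play by (auto simp: play_def)
  show ends: "terminates t\<^sub>s x"
  proof (rule ccontr)
    assume nt: "\<not> terminates t\<^sub>s x"
    note run = mem_running_times_if_not_terminates[OF nt]
    \<comment> \<open>A lower bound for the speed of descent: \<open>e - \<nu> *\<^sub>R ?Y\<close>
      has vertical component at most \<open>1 - \<nu>\<close> and norm at most
      \<open>\<nu> + 1\<close>.\<close>
    define k where "k = v\<^sub>A * ((\<nu> - 1) / (\<nu> + 1))"
    have k: "0 < k"
      using vA \<nu> by (simp add: k_def)
    have drop: "potential 0 ?Y 0 (x t) \<le> potential 0 ?Y 0 x0 + (- k) * (t - t\<^sub>s)"
      if "t\<^sub>s \<le> t" for t
    proof (rule bound[OF run[OF that]])
      fix e :: "real^2" assume e: "norm e = 1"
      let ?u = "e - \<nu> *\<^sub>R ?Y"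
      have "\<nu> - 1 \<le> norm ?u"
        using norm_triangle_ineq3[of e "\<nu> *\<^sub>R ?Y"] e \<nu> by simp
      then have pos: "0 < norm ?u"
        using \<nu> by linarith
      have up: "norm ?u \<le> \<nu> + 1"
        using norm_triangle_ineq4[of e "\<nu> *\<^sub>R ?Y"] e \<nu> by simp
      have "?Y \<bullet> ?u \<le> 1 - \<nu>"
        using component_le_norm_cart[of e 2] e by (simp add: inner_axis')
      have "(\<nu> - 1) / (\<nu> + 1) \<le> - (?Y \<bullet> ?u) / norm ?u"
        using \<nu> pos up \<open>?Y \<bullet> ?u \<le> 1 - \<nu>\<close> by (intro frac_le) auto
      then have "?Y \<bullet> sgn ?u \<le> - ((\<nu> - 1) / (\<nu> + 1))"
        by (simp add: sgn_div_norm divide_inverse mult.commute)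
      then show "v\<^sub>A * ((0 *\<^sub>R e + ?Y) \<bullet> sgn ?u) + v\<^sub>D * norm (0 - 0 *\<^sub>R e) \<le> - k"
        using mult_left_mono[of "?Y \<bullet> sgn ?u" "- ((\<nu> - 1) / (\<nu> + 1))" v\<^sub>A] vA by (simp add: k_def)
    qed
    let ?t = "t\<^sub>s + (snd x0 $ 2 + 1) / k"
    have t: "t\<^sub>s \<le> ?t"
      using k x0 by simp
    have "snd (x ?t) $ 2 \<le> - 1"
      using drop[OF t] k by (simp add: potential_def inner_axis')
    \<comment> \<open>The attacker starts on or above the line and would be below it at
      \<open>?t\<close>, so by continuity it meets the line, which is terminal.\<close>
    moreover have "continuous_on {t\<^sub>s..?t} (\<lambda>t. snd (x t) $ 2)"
      by (intro continuous_intros continuous_on_subset[OF x(2)]) auto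
    ultimately obtain t where "t\<^sub>s \<le> t" "snd (x t) $ 2 = 0"
      using IVT2'[of "\<lambda>t. snd (x t) $ 2" ?t 0 t\<^sub>s] t x0 x(1) by auto
    then show False
      using nt by (auto simp: terminates_def terminal_set_iff)
  qed
  let ?T = "final_time t\<^sub>s x"
  note fin = final_time_attained[OF x(2) ends]
  have pos: "0 < \<nu>\<^sup>2 - 1"
    using \<nu> by (simp add: one_less_power)
  have pot: "potential (- \<nu>) (\<nu>\<^sup>2 *\<^sub>R ?Y) (- ?Y) s = (\<nu>\<^sup>2 - 1) * lowest_intercept \<nu> s" for s
    by (simp add: lowest_intercept_eq[OF \<nu>] potential_def inner_axis')
  \<comment> \<open>The attacker now contributes exactly
    \<open>- v\<^sub>A * \<nu> * norm ?u\<close> and the defender at most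
    \<open>v\<^sub>D * norm ?u\<close>, again with sum \<open>0\<close>.\<close>
  have "potential (- \<nu>) (\<nu>\<^sup>2 *\<^sub>R ?Y) (- ?Y) (x ?T) \<le>
      potential (- \<nu>) (\<nu>\<^sup>2 *\<^sub>R ?Y) (- ?Y) x0 + 0 * (?T - t\<^sub>s)"
  proof (rule bound[OF fin(1)])
    fix e :: "real^2" assume e: "norm e = 1"
    let ?u = "e - \<nu> *\<^sub>R ?Y"
    have "- \<nu> *\<^sub>R e + \<nu>\<^sup>2 *\<^sub>R ?Y = (- \<nu>) *\<^sub>R ?u"
      by (simp add: scaleR_diff_right power2_eq_square)
    then have "(- \<nu> *\<^sub>R e + \<nu>\<^sup>2 *\<^sub>R ?Y) \<bullet> sgn ?u = - \<nu> * norm ?u"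
      by (simp add: inner_sgn_self)
    moreover have "norm (- ?Y - - \<nu> *\<^sub>R e) = norm ?u"
      using norm_scaleR_diff_swap[OF e, of ?Y \<nu>] by simp
    ultimately show "v\<^sub>A * ((- \<nu> *\<^sub>R e + \<nu>\<^sup>2 *\<^sub>R ?Y) \<bullet> sgn ?u) + v\<^sub>D * norm (- ?Y - - \<nu> *\<^sub>R e) \<le> 0"
      by (simp only: vD) simp
  qed
  then have low: "lowest_intercept \<nu> (x ?T) \<le> lowest_intercept \<nu> x0"
    using pos unfolding pot by simp
  show "payoff t\<^sub>s x \<le> max 0 (lowest_intercept \<nu> x0)"
  proof (cases "snd (x ?T) = fst (x ?T)")
    case True
    then have "(\<nu>\<^sup>2 - 1) * lowest_intercept \<nu> (x ?T) = (\<nu>\<^sup>2 - 1) * snd (x ?T) $ 2"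
      unfolding lowest_intercept_eq[OF \<nu>] by (simp add: algebra_simps)
    then show ?thesis
      using low pos by (simp add: payoff_def)
  next
    case False
    then show ?thesis
      using fin(2) by (simp add: terminal_set_iff payoff_def)
  qed
qed

text \<open>Each guarantee holds on every play against any opponent with controls in the unit ball,
  which yields both deviation inequalities; on plays of the pair itself the two guarantees squeeze
  the payoff.\<close>

lemma saddle_point_optimal_policies:
  assumes \<nu>: "1 < \<nu>" and vA: "0 < v\<^sub>A" and vD: "v\<^sub>D = \<nu> * v\<^sub>A" and x0: "0 \<le> snd x0 $ 2"
  shows "saddle_point v\<^sub>D v\<^sub>A t\<^sub>s x0 (defender_policy \<nu>) (attacker_policy \<nu>)
    (max 0 (lowest_intercept \<nu> x0))"
proof -
  note lip = lipschitz_defender_policy[OF \<nu>] lipschitz_attacker_policy[OF \<nu>]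
  have ctrl: "range (defender_policy \<nu>) \<subseteq> controls" "range (attacker_policy \<nu>) \<subseteq> controls"
    using lip by (auto simp: lipschitz_policy_def)
  note D = defender_policy_guarantee[OF _ _ \<nu> vA vD]
  note A = attacker_policy_guarantee[OF _ _ \<nu> vA vD x0]
  have "admissible_D v\<^sub>D v\<^sub>A t\<^sub>s x0 (defender_policy \<nu>)" "admissible_A v\<^sub>D v\<^sub>A t\<^sub>s x0 (attacker_policy \<nu>)"
    using ctrl play_exists lip by (simp_all add: admissible_D_def admissible_A_def)
  moreover have "\<exists>x. play v\<^sub>D v\<^sub>A t\<^sub>s x0 (defender_policy \<nu>) (attacker_policy \<nu>) x"
    by (intro play_exists lip)
  moreover have "payoff t\<^sub>s x = max 0 (lowest_intercept \<nu> x0)"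
    if "play v\<^sub>D v\<^sub>A t\<^sub>s x0 (defender_policy \<nu>) (attacker_policy \<nu>) x" for x
    using A(2)[OF that ctrl(1)] D(2)[OF that ctrl(2)] by (rule antisym)
  ultimately show ?thesis
    unfolding saddle_point_def
    using D A ctrl by (simp add: admissible_D_def admissible_A_def)
qed

theorem theorem1:
  fixes v\<^sub>A v\<^sub>D \<nu> t\<^sub>s \<rho>\<^sub>s r :: real and x\<^sub>A x\<^sub>D c :: "real^2"
  assumes "v\<^sub>A > 0" "v\<^sub>D > 0" "\<nu> = v\<^sub>D / v\<^sub>A" "\<nu> > 1"
    and "x\<^sub>D \<in> environment" "x\<^sub>A \<in> environment"
    and "\<rho>\<^sub>s \<ge> 0" "norm (x\<^sub>A - x\<^sub>D) = \<rho>\<^sub>s"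
    and "c = apollonius_center x\<^sub>A x\<^sub>D \<nu>"
    and "r = apollonius_radius x\<^sub>A x\<^sub>D \<nu>"
  shows "\<forall>j. nash_payoff v\<^sub>D v\<^sub>A t\<^sub>s (x\<^sub>D, x\<^sub>A) j \<longleftrightarrow> j = max 0 (c $ 2 - r)"
proof (intro allI iffI)
  let ?x0 = "(x\<^sub>D, x\<^sub>A) :: state"
  have \<nu>: "1 < \<nu>" and vA: "0 < v\<^sub>A" and vD: "v\<^sub>D = \<nu> * v\<^sub>A" and x0: "0 \<le> snd ?x0 $ 2"
    using assms by (auto simp: environment_def)
  have val: "max 0 (c $ 2 - r) = max 0 (lowest_intercept \<nu> ?x0)"
    using assms by (simp add: lowest_intercept_def)
  note saddle = saddle_point_optimal_policies[OF \<nu> vA vD x0, of t\<^sub>s]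
  fix j
  show "nash_payoff v\<^sub>D v\<^sub>A t\<^sub>s ?x0 j" if "j = max 0 (c $ 2 - r)"
    using saddle that unfolding nash_payoff_def val by blast
  show "j = max 0 (c $ 2 - r)" if "nash_payoff v\<^sub>D v\<^sub>A t\<^sub>s ?x0 j"
  proof -
    obtain \<gamma>\<^sub>D \<gamma>\<^sub>A where sp: "saddle_point v\<^sub>D v\<^sub>A t\<^sub>s ?x0 \<gamma>\<^sub>D \<gamma>\<^sub>A j"
      using \<open>nash_payoff v\<^sub>D v\<^sub>A t\<^sub>s ?x0 j\<close> unfolding nash_payoff_def by blast
    have adm: "admissible_D v\<^sub>D v\<^sub>A t\<^sub>s ?x0 \<gamma>\<^sub>D" "admissible_A v\<^sub>D v\<^sub>A t\<^sub>s ?x0 \<gamma>\<^sub>A"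
      using sp by (auto simp: saddle_point_def)
    have adm': "admissible_D v\<^sub>D v\<^sub>A t\<^sub>s ?x0 (defender_policy \<nu>)"
        "admissible_A v\<^sub>D v\<^sub>A t\<^sub>s ?x0 (attacker_policy \<nu>)"
      using saddle by (auto simp: saddle_point_def)
    \<comment> \<open>The policies of two saddle points need not have a common play, but the optimal
      policies above are Lipschitz, so each of them has a play against any admissible policy.\<close>
    obtain x where x: "play v\<^sub>D v\<^sub>A t\<^sub>s ?x0 \<gamma>\<^sub>D (attacker_policy \<nu>) x"
      using adm(1) lipschitz_attacker_policy[OF \<nu>] unfolding admissible_D_def by blast
    \<comment> \<open>In this play the attacker deviates from the saddle point with value
      \<open>j\<close> and the defender from the one constructed above, so the payoff separates the
      two values. The play \<open>y\<close> exchanges the deviations and gives the reverse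
      inequality.\<close>
    have "j \<le> payoff t\<^sub>s x"
      using sp adm'(2) x unfolding saddle_point_def by blast
    also have "\<dots> \<le> max 0 (lowest_intercept \<nu> ?x0)"
      using saddle adm(1) x unfolding saddle_point_def by blast
    finally have upper: "j \<le> max 0 (lowest_intercept \<nu> ?x0)" .
    obtain y where y: "play v\<^sub>D v\<^sub>A t\<^sub>s ?x0 (defender_policy \<nu>) \<gamma>\<^sub>A y"
      using adm(2) lipschitz_defender_policy[OF \<nu>] unfolding admissible_A_def by blast
    have "max 0 (lowest_intercept \<nu> ?x0) \<le> payoff t\<^sub>s y"
      using saddle adm(2) y unfolding saddle_point_def by blast
    also have "\<dots> \<le> j"
      using sp adm'(1) y unfolding saddle_point_def by blast
    finally show ?thesis
      using upper unfolding val by (rule antisym[rotated])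
  qed
qed

end
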